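(* Let $0<p<\infty$ and let $v$ be a weight on $Y$. The functional $\|\cdot\|_{\Lambda^p_{\mathcal R}(v)}$ is a quasi-norm if and only if there exists a constant $C>0$ such that $$V(\mathcal R(A\cup B))\le C\,\bigl(V(\mathcal R(A))+V(\mathcal R(B))\bigr)$$ for all sets $A,B\in\Sigma_X$.
   Context: $(X,\Sigma_X,\mu)$ and $(Y,\Sigma_Y,\nu)$ are $\sigma$-finite measure spaces and $\mathcal R:\Sigma_X\to\Sigma_Y$ is a set transformation with $\nu(\mathcal R(\emptyset))=0$. For a $\mu$-measurable function $f$ on $X$, its rearrangement is $f^*_{\mathcal R}(y)=\int_0^\infty \chi_{\mathcal R(\{x\in X:|f(x)|>t\})}(y)\,dt$, $y\in Y$ (whenever this defines a $\nu$-measurable function). $\mathcal R$ is assumed to satisfy the Fatou property: for every increasing sequence of non-negative measurable functions $f_n$ on $X$ converging to $f$ $\mu$-a.e., $(f_n)^*_{\mathcal R}$ converges increasingly to $f^*_{\mathcal R}$ $\nu$-a.e. A weight on $Y$ is a function $v\in L^1_{\mathrm{loc}}(Y,d\nu)$ (i.e. integrable over sets of finite $\nu$-measure), $v\ge 0$, such that $\mu(A)>0$ implies $\int_{\mathcal R(A)}v\,d\nu>0$ for $A\in\Sigma_X$. Put $V(E)=\int_E v\,d\nu$ for measurable $E\subset Y$. The Lorentz space $\Lambda^p_{\mathcal R}(v)$ consists of the $\mu$-measurable $f$ on $X$ (modulo $\mu$-a.e. equality) for which $$\|f\|_{\Lambda^p_{\mathcal R}(v)}=\Bigl(\int_Y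 (f^*_{\mathcal R}(y))^p\,v(y)\,d\nu(y)\Bigr)^{1/p}$$ is finite. *)

theory Defs
  imports "HOL-Analysis.Analysis"
begin

definition set_transformation :: "'a measure \<Rightarrow> 'b measure \<Rightarrow> ('a set \<Rightarrow> 'b set) \<Rightarrow> bool" where
  "set_transformation M N R \<longleftrightarrow>
     (\<forall>A\<in>sets M. R A \<in> sets N) \<and> emeasure N (R {}) = 0"

text \<open>
  If the integrand below fails to be measurable in \<open>t\<close> for some \<open>y\<close>, the integral denotes a lower
  integral. Similarly the rearrangement itself is not required to be measurable in \<open>y\<close>. Both are
  harmless under the Fatou property: the rearrangement of a simple function is, off the null set
  \<open>R {}\<close>, a finite linear combination of indicators of measurable sets, so every rearrangement
  agrees almost everywhere with a measurable function, and the Lebesgue integral of an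
  extended non-negative function is unaffected by changes on null sets.
\<close>

definition rearrangement ::
    "'a measure \<Rightarrow> ('a set \<Rightarrow> 'b set) \<Rightarrow> ('a \<Rightarrow> 'k::real_normed_vector) \<Rightarrow> 'b \<Rightarrow> ennreal" where
  "rearrangement M R f y =
     (\<integral>\<^sup>+ t\<in>{0<..}. indicator (R {x \<in> space M. norm (f x) > t}) y \<partial>lborel)"

definition fatou_property :: "'a measure \<Rightarrow> 'b measure \<Rightarrow> ('a set \<Rightarrow> 'b set) \<Rightarrow> bool" where
  "fatou_property M N R \<longleftrightarrow>
     (\<forall>(F :: nat \<Rightarrow> 'a \<Rightarrow> real) f.
        (\<forall>n. F n \<in> borel_measurable M) \<longrightarrow> f \<in> borel_measurable M \<longrightarrow>
        (\<forall>n. \<forall>x\<in>space M. 0 \<le> F n x) \<longrightarrow>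
        (\<forall>n. \<forall>x\<in>space M. F n x \<le> F (Suc n) x) \<longrightarrow>
        (AE x in M. (\<lambda>n. F n x) \<longlonglongrightarrow> f x) \<longrightarrow>
        (AE y in N. incseq (\<lambda>n. rearrangement M R (F n) y) \<and>
                    (\<lambda>n. rearrangement M R (F n) y) \<longlonglongrightarrow> rearrangement M R f y))"

definition weighted_measure :: "'b measure \<Rightarrow> ('b \<Rightarrow> real) \<Rightarrow> 'b set \<Rightarrow> ennreal" where
  "weighted_measure N v E = (\<integral>\<^sup>+ y\<in>E. ennreal (v y) \<partial>N)"

definition weight ::
    "'a measure \<Rightarrow> 'b measure \<Rightarrow> ('a set \<Rightarrow> 'b set) \<Rightarrow> ('b \<Rightarrow> real) \<Rightarrow> bool" where
  "weight M N R v \<longleftrightarrow>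
     v \<in> borel_measurable N \<and>
     (\<forall>E\<in>sets N. emeasure N E < \<infinity> \<longrightarrow> set_integrable N E v) \<and>
     (AE y in N. 0 \<le> v y) \<and>
     (\<forall>A\<in>sets M. emeasure M A > 0 \<longrightarrow> weighted_measure N v (R A) > 0)"

text \<open>Real powers on \<open>[0,\<infinity>]\<close> with a positive exponent, so that \<open>\<infinity>\<close> raised to any power is \<open>\<infinity>\<close>.\<close>

definition ennreal_powr :: "ennreal \<Rightarrow> real \<Rightarrow> ennreal" where
  "ennreal_powr a p = (if a = \<infinity> then \<infinity> else ennreal (enn2real a powr p))"

definition lorentz_norm ::
    "'a measure \<Rightarrow> 'b measure \<Rightarrow> ('a set \<Rightarrow> 'b set) \<Rightarrow> ('b \<Rightarrow> real) \<Rightarrow> real \<Rightarrow>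
     ('a \<Rightarrow> 'k::real_normed_vector) \<Rightarrow> ennreal" where
  "lorentz_norm M N R v p f =
     ennreal_powr (\<integral>\<^sup>+ y. ennreal_powr (rearrangement M R f y) p * ennreal (v y) \<partial>N) (1 / p)"

definition lorentz_space ::
    "'a measure \<Rightarrow> 'b measure \<Rightarrow> ('a set \<Rightarrow> 'b set) \<Rightarrow> ('b \<Rightarrow> real) \<Rightarrow> real \<Rightarrow>
     ('a \<Rightarrow> 'k::real_normed_vector) set" where
  "lorentz_space M N R v p = {f \<in> borel_measurable M. lorentz_norm M N R v p f < \<infinity>}"

text \<open>
  \<open>quasi_norm_mod_ae M S q\<close>: the quotient of \<open>S\<close> by \<open>M\<close>-almost everywhere equality is a vector space
  and \<open>q\<close> induces a quasi-norm on it. This is phrased on representatives, with the compatibility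
  of \<open>S\<close> and \<open>q\<close> with almost everywhere equality as the first clause.
\<close>

definition quasi_norm_mod_ae ::
    "'a measure \<Rightarrow> ('a \<Rightarrow> 'k::real_normed_field) set \<Rightarrow> (('a \<Rightarrow> 'k) \<Rightarrow> ennreal) \<Rightarrow> bool" where
  "quasi_norm_mod_ae M S q \<longleftrightarrow>
     (\<forall>f\<in>S. \<forall>g\<in>borel_measurable M. (AE x in M. f x = g x) \<longrightarrow> g \<in> S \<and> q g = q f) \<and>
     (\<lambda>x. 0) \<in> S \<and>
     (\<forall>f\<in>S. \<forall>g\<in>S. (\<lambda>x. f x + g x) \<in> S) \<and>
     (\<forall>f\<in>S. \<forall>c. (\<lambda>x. c * f x) \<in> S) \<and>
     (\<forall>f\<in>S. q f < \<infinity>) \<and>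
     (\<forall>f\<in>S. q f = 0 \<longleftrightarrow> (AE x in M. f x = 0)) \<and>
     (\<forall>f\<in>S. \<forall>c. q (\<lambda>x. c * f x) = ennreal (norm c) * q f) \<and>
     (\<exists>K::real. K > 0 \<and> (\<forall>f\<in>S. \<forall>g\<in>S. q (\<lambda>x. f x + g x) \<le> ennreal K * (q f + q g)))"

end

theory Submission
  imports Defs
begin

text \<open>
  The functional is a weighted \<open>L\<^sup>p\<close> quantity built from the level sets of \<open>\<bar>f\<bar>\<close>, and up to constants
  only the dyadic level sets matter:
  \<open>\<integral> (f\<^sup>*)\<^sup>p v \<approx> \<Sum>\<^sub>j 2\<^sup>j\<^sup>p V (R {\<bar>f\<bar> > 2\<^sup>j})\<close>, the sum running over all integers \<open>j\<close>
  (\<open>dyadic_sum_le_modular\<close>, \<open>modular_le_dyadic_sum\<close>). Given this, sufficiency is immediate: since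
  \<open>{\<bar>f + g\<bar> > 2\<^sup>j} \<subseteq> {\<bar>f\<bar> > 2\<^sup>j\<^sup>-\<^sup>1} \<union> {\<bar>g\<bar> > 2\<^sup>j\<^sup>-\<^sup>1}\<close>, the inequality for \<open>V \<circ> R\<close> bounds each term for
  \<open>f + g\<close> by terms for \<open>f\<close> and \<open>g\<close>, and shifting the index by one costs a factor \<open>2\<^sup>p\<close>
  (\<open>modular_add_le\<close>). For necessity the quasi-triangle inequality is tested on the indicators of
  \<open>A\<close> and \<open>B\<close>, whose \<open>p\<close>-th power functionals are \<open>V (R A)\<close> and \<open>V (R B)\<close> and whose sum dominates
  the indicator of \<open>A \<union> B\<close>.

  The point of going dyadic is that a rearrangement involves uncountably many level sets at each
  \<open>y\<close>, whereas the Fatou property controls the sets \<open>R A\<close> only up to a null set each time it is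
  applied. It does yield that \<open>f\<^sup>* \<le> g\<^sup>*\<close> almost everywhere when \<open>\<bar>f\<bar> \<le> \<bar>g\<bar>\<close>: apply it to the sequence
  \<open>\<bar>f\<bar>, \<bar>g\<bar>, \<bar>g\<bar>, \<dots>\<close>. Let \<open>D\<close> be \<open>\<bar>f\<bar>\<close> rounded down to a power of two. Then \<open>f\<^sup>*\<close> lies almost
  everywhere between \<open>D\<^sup>*\<close> and \<open>(2 D)\<^sup>* = 2 D\<^sup>*\<close>, and \<open>2 D\<^sup>*(y)\<close> is exactly the sum of those \<open>2\<^sup>j\<close> with \<open>y \<in> R {\<bar>f\<bar> > 2\<^sup>j}\<close>
  (\<open>rearrangement_dyadic_floor\<close>). Off a null set these \<open>j\<close> form a down-closed set of integers, so
  that sum is geometric and its \<open>p\<close>-th power is the sum of the \<open>p\<close>-th powers times \<open>2\<^sup>p - 1\<close>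
  (\<open>dyadic_sum_downset\<close>), which can then be integrated term by term.

  Definiteness uses the same comparison: if the functional vanishes, then \<open>V (R {\<bar>f\<bar> > 2\<^sup>j}) = 0\<close> for
  every \<open>j\<close>, and the positivity condition on the weight makes every set \<open>{\<bar>f\<bar> > 2\<^sup>j}\<close> null.
\<close>

section \<open>Powers and geometric sums of extended non-negative numbers\<close>

lemma ennreal_powr_ennreal [simp]: "0 \<le> x \<Longrightarrow> ennreal_powr (ennreal x) p = ennreal (x powr p)"
  by (simp add: ennreal_powr_def)

lemma ennreal_powr_top [simp]: "ennreal_powr top p = top"
  by (simp add: ennreal_powr_def)

lemma ennreal_powr_0 [simp]: "ennreal_powr 0 p = 0"
  by (simp add: ennreal_powr_def)

lemma ennreal_powr_one [simp]: "ennreal_powr 1 p = 1"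
  by (simp add: ennreal_powr_def)

lemma ennreal_powr_eq_0_iff [simp]: "ennreal_powr a p = 0 \<longleftrightarrow> a = 0"
  by (cases a) auto

lemma ennreal_powr_less_top_iff [simp]: "ennreal_powr a p < top \<longleftrightarrow> a < top"
  by (cases a) auto

lemma ennreal_powr_mono: "a \<le> b \<Longrightarrow> 0 \<le> p \<Longrightarrow> ennreal_powr a p \<le> ennreal_powr b p"
  by (cases a; cases b) (auto simp: powr_mono2 top_unique)

lemma ennreal_powr_mult: "ennreal_powr (a * b) p = ennreal_powr a p * ennreal_powr b p"
proof -
  have *: "ennreal_powr (top * c) p = top * ennreal_powr c p" for c
    by (cases "c = 0") (auto simp: ennreal_top_mult)
  show ?thesis
  proof (cases "a = top \<or> b = top")
    case True
    then show ?thesis using *[of a] *[of b] by (auto simp: mult.commute)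
  next
    case False
    then obtain x y where "a = ennreal x" "0 \<le> x" "b = ennreal y" "0 \<le> y"
      by (metis ennreal_cases)
    then show ?thesis by (simp add: powr_mult flip: ennreal_mult)
  qed
qed

lemma ennreal_powr_powr: "ennreal_powr (ennreal_powr a p) q = ennreal_powr a (p * q)"
  by (cases a) (auto simp: powr_powr)

lemma ennreal_powr_exponent_1: "ennreal_powr a 1 = a"
  by (cases a) auto

lemma ennreal_powr_add_le:
  assumes "0 \<le> r"
  shows "ennreal_powr (a + b) r \<le> ennreal (2 powr r) * (ennreal_powr a r + ennreal_powr b r)"
proof -
  have "a + b \<le> ennreal 2 * max a b"
    by (simp add: mult_2 add_mono)
  then have "ennreal_powr (a + b) r \<le> ennreal_powr (ennreal 2 * max a b) r"
    using assms by (rule ennreal_powr_mono)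
  also have "\<dots> = ennreal (2 powr r) * ennreal_powr (max a b) r"
    unfolding ennreal_powr_mult by (subst ennreal_powr_ennreal) auto
  also have "ennreal_powr (max a b) r \<le> ennreal_powr a r + ennreal_powr b r"
    by (auto simp: max_def)
  finally show ?thesis
    by (simp add: mult_left_mono)
qed

lemma one_less_two_powr: "0 < p \<Longrightarrow> 1 < (2::real) powr p"
  using powr_less_mono[of 0 p 2] by simp

text \<open>
  A down-closed set of integers is empty, everything, or \<open>{..J}\<close>. In the last case both sides are
  \<open>2 powr (p * (J + 1))\<close> because \<open>(2 powr q - 1) * T q = 2 powr (q * (J + 1))\<close> for every \<open>q > 0\<close>, by
  the geometric series downwards from \<open>J\<close>; otherwise both are \<open>0\<close> or both infinite.
\<close>

lemma dyadic_sum_downset: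
  fixes P :: "int \<Rightarrow> bool"
  assumes p: "0 < p" and down: "\<And>i j. i \<le> j \<Longrightarrow> P j \<Longrightarrow> P i"
  defines "T \<equiv> (\<lambda>q. \<integral>\<^sup>+j. ennreal (2 powr (q * j)) * indicator {j. P j} j \<partial>count_space UNIV)"
  shows "ennreal_powr (T 1) p = ennreal (2 powr p - 1) * T p"
proof -
  consider "\<forall>j. \<not> P j" | "\<forall>j. P j" | J where "\<forall>j. P j \<longleftrightarrow> j \<le> J"
  proof (cases "(\<forall>j. \<not> P j) \<or> (\<forall>j. P j)")
    case True
    then show ?thesis using that(1,2) by argo
  next
    case False
    then obtain a b where a: "P a" and b: "\<not> P b" by blast
    let ?A = "{j. a \<le> j \<and> P j}"
    have "?A \<subseteq> {a..b}" using b down by (auto intro: linear) (metis linear)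
    then have fin: "finite ?A" by (rule finite_subset) simp
    have "P (Max ?A)" using Max_in[OF fin] a by auto
    moreover have "j \<le> Max ?A" if "P j" for j
    proof (cases "a \<le> j")
      case True
      then show ?thesis using Max_ge[OF fin] that by auto
    next
      case False
      moreover have "a \<le> Max ?A" using Max_ge[OF fin] a by auto
      ultimately show ?thesis by simp
    qed
    ultimately have "\<forall>j. P j \<longleftrightarrow> j \<le> Max ?A" using down by metis
    then show ?thesis by (rule that(3))
  qed
  then show ?thesis
  proof cases
    case 1
    then show ?thesis by (simp add: T_def)
  next
    case 2
    have "T q = top" if q: "0 < q" for q
    proof -
      have le: "ennreal (2 powr (q * j)) \<le> T q" for j :: int
      proof -
        have "ennreal (2 powr (q * j)) = (\<integral>\<^sup>+i. ennreal (2 powr (q * i)) * indicator {j} i \<partial>count_space UNIV)"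
          by (subst nn_integral_indicator_singleton) auto
        also have "\<dots> \<le> T q"
          unfolding T_def using 2 by (intro nn_integral_mono) (auto split: split_indicator)
        finally show ?thesis .
      qed
      have "ennreal B \<le> T q" for B
      proof -
        \<comment> \<open>any \<open>j\<close> with \<open>2 powr (q * j) \<ge> B\<close> will do; the maximum keeps the logarithm defined\<close>
        define j where "j = \<lceil>log 2 (max B 1) / q\<rceil>"
        have "log 2 (max B 1) \<le> q * j"
          using q by (simp add: j_def mult.commute[of q] flip: pos_divide_le_eq)
        then have "max B 1 \<le> 2 powr (q * j)"
          by (subst (asm) log_le_iff) auto
        then have "ennreal B \<le> ennreal (2 powr (q * j))"
          by (intro ennreal_leI) auto
        with le show ?thesis by (rule order_trans[rotated])
      qed
      from this[of "enn2real (T q) + 1"] show ?thesis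
        by (cases "T q") auto
    qed
    moreover have "ennreal (2 powr p - 1) \<noteq> 0" using p by (simp add: ennreal_eq_0_iff not_le one_less_two_powr)
    ultimately show ?thesis using p by (simp add: ennreal_mult_top)
  next
    case (3 J)
    have "ennreal (2 powr q - 1) * T q = ennreal (2 powr (q * (J + 1)))" if q: "0 < q" for q
    proof -
      have small: "2 powr (- q) < 1" using q by (simp add: powr_less_one)
      have "T q = (\<integral>\<^sup>+j. ennreal (2 powr (q * j)) \<partial>count_space {..J})"
      proof -
        have "{j. P j} = {..J}" using 3 by auto
        then show ?thesis unfolding T_def by (simp add: nn_integral_count_space_indicator)
      qed
      also have "\<dots> = (\<integral>\<^sup>+n. ennreal (2 powr (q * (J - int n))) \<partial>count_space UNIV)"
        by (rule nn_integral_bij_count_space[symmetric])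
           (rule bij_betwI[where g = "\<lambda>j. nat (J - j)"], auto)
      also have "\<dots> = (\<Sum>n. ennreal (2 powr (q * J) * (2 powr (- q)) ^ n))"
      proof -
        have "2 powr (q * (J - int n)) = 2 powr (q * J) * (2 powr (- q)) ^ n" for n
          by (subst powr_realpow[symmetric])
             (simp_all add: powr_powr right_diff_distrib flip: powr_add)
        then show ?thesis by (simp add: nn_integral_count_space_nat)
      qed
      also have "\<dots> = ennreal (2 powr (q * J) * (1 / (1 - 2 powr (- q))))"
      proof (rule suminf_ennreal_eq)
        show "(\<lambda>n. 2 powr (q * J) * (2 powr (- q)) ^ n) sums (2 powr (q * J) * (1 / (1 - 2 powr (- q))))"
          using small by (intro sums_mult geometric_sums) auto
      qed auto
      finally have "ennreal (2 powr q - 1) * T q =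
          ennreal ((2 powr q - 1) * (2 powr (q * J) * (1 / (1 - 2 powr (- q)))))"
        using q small by (subst ennreal_mult) (auto simp: ge_one_powr_ge_zero)
      also have "(2 powr q - 1) * (2 powr (q * J) * (1 / (1 - 2 powr (- q)))) = 2 powr (q * (J + 1))"
        using q small by (simp add: powr_minus divide_simps powr_add algebra_simps)
      finally show ?thesis .
    qed
    from this[of 1] this[OF p] show ?thesis
      by (simp add: powr_powr mult.commute)
  qed
qed

section \<open>Homogeneity of the lower integral\<close>

text \<open>
  For fixed \<open>y\<close> the integrand of a rearrangement is an arbitrary function of \<open>t\<close>, and a rearrangement
  need not be measurable in \<open>y\<close>. The integral is then only a lower integral, which is not additive.
  It is still homogeneous, because multiplication by a positive constant, and likewise a dilation
  of the line, carries the simple minorants of one integrand onto those of the other. In both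
  cases one inequality is proved for every positive constant, and the reverse one follows from it
  with the reciprocal constant.
\<close>

lemma nn_integral_cmult_finite:
  assumes c: "0 < c"
  shows "(\<integral>\<^sup>+x. ennreal c * f x \<partial>M) = ennreal c * (\<integral>\<^sup>+x. f x \<partial>M)"
proof -
  have le: "ennreal b * (\<integral>\<^sup>+x. h x \<partial>M) \<le> (\<integral>\<^sup>+x. ennreal b * h x \<partial>M)" for b h
    unfolding nn_integral_def[of M h] SUP_mult_left_ennreal
  proof (rule SUP_least)
    fix g assume g: "g \<in> {g. simple_function M g \<and> g \<le> h}"
    then have "ennreal b * integral\<^sup>S M g = (\<integral>\<^sup>+x. ennreal b * g x \<partial>M)"
      by (simp add: nn_integral_eq_simple_integral nn_integral_cmult borel_measurable_simple_function)
    also have "\<dots> \<le> (\<integral>\<^sup>+x. ennreal b * h x \<partial>M)"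
      using g by (intro nn_integral_mono mult_left_mono) (auto simp: le_fun_def)
    finally show "ennreal b * integral\<^sup>S M g \<le> (\<integral>\<^sup>+x. ennreal b * h x \<partial>M)" .
  qed
  have inv: "ennreal c * ennreal (1 / c) = 1"
    using c by (simp flip: ennreal_mult)
  have "ennreal (1 / c) * (\<integral>\<^sup>+x. ennreal c * f x \<partial>M) \<le> (\<integral>\<^sup>+x. f x \<partial>M)"
    using le[of "1 / c" "\<lambda>x. ennreal c * f x"] inv by (simp add: mult.assoc[symmetric] mult.commute)
  then have "ennreal c * (ennreal (1 / c) * (\<integral>\<^sup>+x. ennreal c * f x \<partial>M)) \<le> ennreal c * (\<integral>\<^sup>+x. f x \<partial>M)"
    by (rule mult_left_mono) simp
  then have "(\<integral>\<^sup>+x. ennreal c * f x \<partial>M) \<le> ennreal c * (\<integral>\<^sup>+x. f x \<partial>M)"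
    unfolding mult.assoc[symmetric] inv by simp
  then show ?thesis using le by (rule antisym)
qed

lemma nn_integral_lborel_scale_le:
  fixes f :: "real \<Rightarrow> ennreal"
  assumes c: "0 < c"
  shows "(\<integral>\<^sup>+t. f t \<partial>lborel) \<le> ennreal c * (\<integral>\<^sup>+t. f (c * t) \<partial>lborel)"
  unfolding nn_integral_def[of lborel f]
proof (rule SUP_least)
  fix g assume g: "g \<in> {g. simple_function lborel g \<and> g \<le> f}"
  then have m: "g \<in> borel_measurable borel"
    using borel_measurable_simple_function[of lborel g] by simp
  have "integral\<^sup>S lborel g = (\<integral>\<^sup>+t. g t \<partial>lborel)"
    using g by (simp add: nn_integral_eq_simple_integral)
  also have "\<dots> = ennreal c * (\<integral>\<^sup>+t. g (c * t) \<partial>lborel)"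
    using nn_integral_real_affine[OF m, of c 0] c by simp
  also have "\<dots> \<le> ennreal c * (\<integral>\<^sup>+t. f (c * t) \<partial>lborel)"
    using g by (intro mult_left_mono nn_integral_mono) (auto simp: le_fun_def)
  finally show "integral\<^sup>S lborel g \<le> ennreal c * (\<integral>\<^sup>+t. f (c * t) \<partial>lborel)" .
qed

lemma nn_integral_lborel_scale:
  fixes f :: "real \<Rightarrow> ennreal"
  assumes c: "0 < c"
  shows "(\<integral>\<^sup>+t. f t \<partial>lborel) = ennreal c * (\<integral>\<^sup>+t. f (c * t) \<partial>lborel)"
proof (rule antisym)
  have "(\<integral>\<^sup>+t. f (c * t) \<partial>lborel) \<le> ennreal (1 / c) * (\<integral>\<^sup>+t. f t \<partial>lborel)"
    using nn_integral_lborel_scale_le[of "1 / c" "\<lambda>t. f (c * t)"] c by simp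
  then have "ennreal c * (\<integral>\<^sup>+t. f (c * t) \<partial>lborel) \<le> (ennreal c * ennreal (1 / c)) * (\<integral>\<^sup>+t. f t \<partial>lborel)"
    unfolding mult.assoc by (rule mult_left_mono) simp
  also have "ennreal c * ennreal (1 / c) = 1"
    using c by (simp flip: ennreal_mult)
  finally show "ennreal c * (\<integral>\<^sup>+t. f (c * t) \<partial>lborel) \<le> (\<integral>\<^sup>+t. f t \<partial>lborel)" by simp
qed (rule nn_integral_lborel_scale_le[OF c])

section \<open>Rearrangements under the Fatou property\<close>

lemma rearrangement_norm: "rearrangement M R (\<lambda>x. norm (f x)) = rearrangement M R f"
  by (simp add: rearrangement_def fun_eq_iff)

lemma rearrangement_scale:
  fixes f :: "'a \<Rightarrow> 'k::real_normed_div_algebra"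
  assumes c: "c \<noteq> 0"
  shows "rearrangement M R (\<lambda>x. c * f x) y = ennreal (norm c) * rearrangement M R f y"
proof -
  have "{x \<in> space M. norm (c * f x) > norm c * t} = {x \<in> space M. norm (f x) > t}" for t
    using c by (auto simp: norm_mult)
  moreover have "indicator {0<..} (norm c * t) = (indicator {0<..} t :: ennreal)" for t
    using c by (auto simp: zero_less_mult_iff split: split_indicator)
  ultimately show ?thesis
    unfolding rearrangement_def using c by (subst nn_integral_lborel_scale[of "norm c"]) simp_all
qed

locale fatou_transformation =
  fixes M :: "'a measure" and N :: "'b measure" and R :: "'a set \<Rightarrow> 'b set"
  assumes transformation: "set_transformation M N R"
    and fatou: "fatou_property M N R"
begin

lemma sets_R [measurable]: "A \<in> sets M \<Longrightarrow> R A \<in> sets N"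
  using transformation by (simp add: set_transformation_def)

lemma AE_notin_R_empty: "AE y in N. y \<notin> R {}"
  using transformation sets_R[of "{}"] by (intro AE_not_in) (auto simp: set_transformation_def null_sets_def)

text \<open>
  This is the monotonicity part of the Fatou property for the sequence \<open>norm f, norm g, norm g, \<dots>\<close>.
\<close>

lemma rearrangement_mono_AE:
  fixes f :: "'a \<Rightarrow> 'k::real_normed_vector" and g :: "'a \<Rightarrow> 'l::real_normed_vector"
  assumes f [measurable]: "f \<in> borel_measurable M" and g [measurable]: "g \<in> borel_measurable M"
    and le: "\<And>x. x \<in> space M \<Longrightarrow> norm (f x) \<le> norm (g x)"
  shows "AE y in N. rearrangement M R f y \<le> rearrangement M R g y"
proof -
  define F where "F = (\<lambda>n::nat. \<lambda>x. if n = 0 then norm (f x) else norm (g x))"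
  have "AE y in N. incseq (\<lambda>n. rearrangement M R (F n) y)"
  proof -
    have m: "F n \<in> borel_measurable M" for n by (cases "n = 0") (auto simp: F_def)
    have l: "(\<lambda>n. F n x) \<longlonglongrightarrow> norm (g x)" for x
      by (rule tendsto_eventually) (auto simp: F_def eventually_sequentially intro!: exI[of _ 1])
    show ?thesis
      using fatou[unfolded fatou_property_def, rule_format, of F "\<lambda>x. norm (g x)"] m l le
      by (auto simp: F_def)
  qed
  moreover have "F 0 = (\<lambda>x. norm (f x))" "F 1 = (\<lambda>x. norm (g x))" by (auto simp: F_def)
  ultimately show ?thesis
    by (auto dest!: incseqD[of _ 0 1] simp: rearrangement_norm)
qed

text \<open>
  A constant sequence \<open>norm f\<close> converges almost everywhere to \<open>norm g\<close>, so the Fatou property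
  identifies the two rearrangements.
\<close>

lemma rearrangement_cong_AE:
  fixes f g :: "'a \<Rightarrow> 'k::real_normed_vector"
  assumes [measurable]: "f \<in> borel_measurable M" "g \<in> borel_measurable M"
    and eq: "AE x in M. f x = g x"
  shows "AE y in N. rearrangement M R f y = rearrangement M R g y"
proof -
  have "AE y in N. incseq (\<lambda>n::nat. rearrangement M R (\<lambda>x. norm (f x)) y) \<and>
          (\<lambda>n::nat. rearrangement M R (\<lambda>x. norm (f x)) y) \<longlonglongrightarrow> rearrangement M R (\<lambda>x. norm (g x)) y"
    using eq by (intro fatou[unfolded fatou_property_def, rule_format, of "\<lambda>n x. norm (f x)"]) auto
  then show ?thesis
    by (auto simp: rearrangement_norm LIMSEQ_const_iff)
qed

lemma rearrangement_indicator:
  assumes "y \<notin> R {}" "A \<subseteq> space M"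
  shows "rearrangement M R (\<lambda>x. if x \<in> A then 1 else 0 :: 'k::real_normed_algebra_1) y = indicator (R A) y"
proof -
  have *: "{x \<in> space M. norm (if x \<in> A then 1 else 0 :: 'k) > t} = (if t < 1 then A else {})"
    if "t > 0" for t using assms that by auto
  then have "rearrangement M R (\<lambda>x. if x \<in> A then 1 else 0 :: 'k) y =
      (\<integral>\<^sup>+ t. indicator (R A) y * indicator {0<..<1::real} t \<partial>lborel)"
    unfolding rearrangement_def
  proof (intro nn_integral_cong)
    fix t :: real
    show "indicator (R {x \<in> space M. t < norm (if x \<in> A then 1 else 0 :: 'k)}) y * indicator {0<..} t =
        (indicator (R A) y * indicator {0<..<1} t :: ennreal)"
    proof (cases "0 < t")
      case True
      show ?thesis unfolding *[OF True] using True assms(1) by (simp split: split_indicator)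
    qed simp
  qed
  then show ?thesis by (simp add: nn_integral_cmult)
qed

text \<open>
  Off the null set \<open>R {}\<close> the rearrangement of the indicator of \<open>A\<close> is the indicator of \<open>R A\<close>, so
  monotonicity of rearrangements becomes monotonicity of \<open>R\<close> up to a null set.
\<close>

lemma R_mono_AE:
  assumes [measurable]: "A \<in> sets M" "B \<in> sets M" and "A \<subseteq> B"
  shows "AE y in N. y \<in> R A \<longrightarrow> y \<in> R B"
proof -
  have "AE y in N. rearrangement M R (\<lambda>x. if x \<in> A then 1 else 0 :: real) y
                 \<le> rearrangement M R (\<lambda>x. if x \<in> B then 1 else 0 :: real) y"
    using \<open>A \<subseteq> B\<close> by (intro rearrangement_mono_AE) auto
  with AE_notin_R_empty show ?thesis
    by eventually_elim
       (use assms in \<open>auto simp: rearrangement_indicator sets.sets_into_space split: split_indicator_asm\<close>)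
qed

end

section \<open>Dyadic discretisation\<close>

text \<open>
  For \<open>r > 0\<close> this is the power \<open>2\<^sup>k\<close> with \<open>2\<^sup>k < r \<le> 2\<^sup>k\<^sup>+\<^sup>1\<close>. The strict inequality is on the left so
  that the strict superlevel sets of \<open>dyadic_floor \<circ> h\<close> are strict superlevel sets of \<open>h\<close>.
\<close>

definition dyadic_floor :: "real \<Rightarrow> real" where
  "dyadic_floor r = (if r \<le> 0 then 0 else 2 powr (\<lceil>log 2 r\<rceil> - 1))"

lemma measurable_dyadic_floor [measurable]: "dyadic_floor \<in> borel_measurable borel"
  unfolding dyadic_floor_def by measurable

lemma dyadic_floor_nonneg: "0 \<le> dyadic_floor r"
  by (simp add: dyadic_floor_def)

lemma dyadic_floor_bounds:
  assumes "0 \<le> r"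
  shows "dyadic_floor r \<le> r" "r \<le> 2 * dyadic_floor r"
proof -
  have "dyadic_floor r \<le> r \<and> r \<le> 2 * dyadic_floor r"
  proof (cases "r = 0")
    case False
    with assms have r: "r > 0" by simp
    have "2 powr (\<lceil>log 2 r\<rceil> - 1) \<le> 2 powr log 2 r" "2 powr log 2 r \<le> 2 powr \<lceil>log 2 r\<rceil>"
      by (auto intro!: powr_mono) 
    with r show ?thesis by (simp add: dyadic_floor_def powr_diff)
  qed (simp add: dyadic_floor_def)
  then show "dyadic_floor r \<le> r" "r \<le> 2 * dyadic_floor r" by auto
qed

lemma less_dyadic_floor_iff:
  fixes j :: int
  assumes "0 \<le> r" "2 powr (j - 1) \<le> t" "t < 2 powr j"
  shows "t < dyadic_floor r \<longleftrightarrow> 2 powr j < r"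
proof (cases "r = 0")
  case True
  with assms show ?thesis
    by (smt (verit) dyadic_floor_def powr_ge_zero)
next
  case False
  with assms have r: "r > 0" by simp
  define k where "k = \<lceil>log 2 r\<rceil> - 1"
  have D: "dyadic_floor r = 2 powr k" using r by (simp add: dyadic_floor_def k_def)
  have "t < 2 powr k \<longleftrightarrow> j \<le> k"
  proof
    assume "t < 2 powr k"
    with assms(2) have "2 powr real_of_int (j - 1) < 2 powr real_of_int k"
      by (rule le_less_trans)
    then show "j \<le> k" by simp
  next
    assume "j \<le> k"
    then have "2 powr real_of_int j \<le> 2 powr real_of_int k" by simp
    with assms(3) show "t < 2 powr k" by linarith
  qed
  also have "\<dots> \<longleftrightarrow> j < log 2 r" by (simp add: k_def) linarith
  also have "\<dots> \<longleftrightarrow> 2 powr j < r" using r by (simp add: less_log_iff)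
  finally show ?thesis using D by simp
qed

definition dyadic_level :: "'a measure \<Rightarrow> ('a \<Rightarrow> 'k::real_normed_vector) \<Rightarrow> int \<Rightarrow> 'a set" where
  "dyadic_level M f j = {x \<in> space M. norm (f x) > 2 powr j}"

text \<open>
  For \<open>t\<close> in \<open>[2\<^sup>j\<^sup>-\<^sup>1, 2\<^sup>j)\<close> the superlevel set at height \<open>t\<close> is the dyadic level \<open>j\<close>, and this interval
  has length \<open>2\<^sup>j\<^sup>-\<^sup>1\<close>. Hence the identity holds at every \<open>y\<close>, with no exceptional set.
\<close>

lemma rearrangement_dyadic_floor:
  "rearrangement M R (\<lambda>x. dyadic_floor (norm (f x))) y =
     (\<integral>\<^sup>+j. ennreal (2 powr (real_of_int j - 1)) * indicator (R (dyadic_level M f j)) y \<partial>count_space UNIV)"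
proof -
  let ?I = "\<lambda>j::int. {2 powr (j - 1)..<2 powr j}"
  have *: "indicator (R {x \<in> space M. norm (dyadic_floor (norm (f x))) > t}) y * indicator {0<..} t =
     (\<integral>\<^sup>+j. indicator (R (dyadic_level M f j)) y * indicator (?I j) t \<partial>count_space UNIV)" for t
  proof (cases "0 < t")
    case True
    define i where "i = \<lfloor>log 2 t\<rfloor> + 1"
    have in_iff: "t \<in> ?I j \<longleftrightarrow> j = i" for j
    proof -
      have "t \<in> ?I j \<longleftrightarrow> j - 1 \<le> log 2 t \<and> log 2 t < j"
        using True by (auto simp: le_log_iff log_less_iff)
      also have "\<dots> \<longleftrightarrow> j = i" by (auto simp: i_def) linarith+
      finally show ?thesis .
    qed
    have "{x \<in> space M. norm (dyadic_floor (norm (f x))) > t} = dyadic_level M f i"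
      using in_iff[of i] less_dyadic_floor_iff[of _ i t]
      by (auto simp: dyadic_level_def dyadic_floor_nonneg)
    moreover have "(\<integral>\<^sup>+j. indicator (R (dyadic_level M f j)) y * indicator (?I j) t \<partial>count_space UNIV)
        = (\<integral>\<^sup>+j. indicator (R (dyadic_level M f j)) y * indicator {i} j \<partial>count_space UNIV)"
      using in_iff by (intro nn_integral_cong) (auto split: split_indicator)
    ultimately show ?thesis using True
      by (simp add: nn_integral_indicator_singleton)
  next
    case False
    moreover have "t \<notin> ?I j" for j
    proof
      assume "t \<in> ?I j"
      moreover have "0 < 2 powr real_of_int (j - 1)" by simp
      ultimately show False using False by (simp only: atLeastLessThan_iff not_less) linarith
    qed
    ultimately show ?thesis by simp
  qed
  have "rearrangement M R (\<lambda>x. dyadic_floor (norm (f x))) y =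
      (\<integral>\<^sup>+t. (\<integral>\<^sup>+j. indicator (R (dyadic_level M f j)) y * indicator (?I j) t \<partial>count_space UNIV) \<partial>lborel)"
    unfolding rearrangement_def * ..
  also have "\<dots> = (\<integral>\<^sup>+j. (\<integral>\<^sup>+t. indicator (R (dyadic_level M f j)) y * indicator (?I j) t \<partial>lborel) \<partial>count_space UNIV)"
    by (rule nn_integral_count_space_nn_integral) auto
  also have "\<dots> = (\<integral>\<^sup>+j. ennreal (2 powr (j - 1)) * indicator (R (dyadic_level M f j)) y \<partial>count_space UNIV)"
    by (intro nn_integral_cong) (simp add: nn_integral_cmult powr_diff mult.commute)
  finally show ?thesis .
qed


lemma sets_dyadic_level [measurable]:
  "f \<in> borel_measurable M \<Longrightarrow> dyadic_level M f j \<in> sets M"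
  unfolding dyadic_level_def by measurable

lemma dyadic_level_antimono: "i \<le> j \<Longrightarrow> dyadic_level M f j \<subseteq> dyadic_level M f i"
  by (auto simp: dyadic_level_def intro: le_less_trans[rotated])

lemma dyadic_level_add:
  "dyadic_level M (\<lambda>x. f x + g x) j \<subseteq> dyadic_level M f (j - 1) \<union> dyadic_level M g (j - 1)"
proof
  fix x assume "x \<in> dyadic_level M (\<lambda>x. f x + g x) j"
  then have x: "x \<in> space M" and "2 powr j < norm (f x + g x)"
    by (auto simp: dyadic_level_def)
  moreover have "(2::real) powr j = 2 powr (j - 1) + 2 powr (j - 1)"
    by (simp add: powr_diff)
  moreover have "norm (f x + g x) \<le> norm (f x) + norm (g x)"
    by (rule norm_triangle_ineq)
  ultimately have "2 powr (j - 1) < norm (f x) \<or> 2 powr (j - 1) < norm (g x)"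
    by linarith
  with x show "x \<in> dyadic_level M f (j - 1) \<union> dyadic_level M g (j - 1)"
    by (auto simp: dyadic_level_def)
qed

section \<open>The Lorentz functional as a dyadic sum\<close>

locale weighted_transformation = fatou_transformation M N R
  for M :: "'a measure" and N :: "'b measure" and R +
  fixes v :: "'b \<Rightarrow> real" and p :: real
  assumes weight: "weight M N R v" and p: "0 < p"
begin

text \<open>
  The \<open>p\<close>-th power of the Lorentz functional. Its comparison with \<open>dyadic_sum\<close> is linear, so the
  estimates are made for it and the root is taken only at the end.
\<close>

definition modular :: "('a \<Rightarrow> 'k::real_normed_vector) \<Rightarrow> ennreal" where
  "modular f = (\<integral>\<^sup>+y. ennreal_powr (rearrangement M R f y) p * ennreal (v y) \<partial>N)"

definition dyadic_sum :: "('a \<Rightarrow> 'k::real_normed_vector) \<Rightarrow> ennreal" where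
  "dyadic_sum f =
     (\<integral>\<^sup>+j. ennreal (2 powr (p * j)) * weighted_measure N v (R (dyadic_level M f j)) \<partial>count_space UNIV)"

lemma lorentz_norm_eq_modular: "lorentz_norm M N R v p f = ennreal_powr (modular f) (1 / p)"
  by (simp add: lorentz_norm_def modular_def)

lemma measurable_weight [measurable]: "v \<in> borel_measurable N"
  using weight by (simp add: weight_def)

lemma weighted_measure_R_mono:
  assumes [measurable]: "A \<in> sets M" "B \<in> sets M" and "A \<subseteq> B"
  shows "weighted_measure N v (R A) \<le> weighted_measure N v (R B)"
  unfolding weighted_measure_def
  using R_mono_AE[OF assms]
  by (intro nn_integral_mono_AE) (auto split: split_indicator)

lemma modular_mono:
  assumes "f \<in> borel_measurable M" "g \<in> borel_measurable M"
    and "\<And>x. x \<in> space M \<Longrightarrow> norm (f x) \<le> norm (g x)"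
  shows "modular f \<le> modular g"
  unfolding modular_def using rearrangement_mono_AE[OF assms] p
  by (intro nn_integral_mono_AE) (auto intro!: mult_right_mono ennreal_powr_mono)

lemma modular_scale:
  fixes f :: "'a \<Rightarrow> 'k::real_normed_div_algebra"
  assumes "c \<noteq> 0"
  shows "modular (\<lambda>x. c * f x) = ennreal (norm c powr p) * modular f"
proof -
  have "modular (\<lambda>x. c * f x) =
      (\<integral>\<^sup>+y. ennreal (norm c powr p) * (ennreal_powr (rearrangement M R f y) p * ennreal (v y)) \<partial>N)"
    using assms by (simp add: modular_def rearrangement_scale ennreal_powr_mult mult.assoc)
  also have "\<dots> = ennreal (norm c powr p) * modular f"
    unfolding modular_def using assms by (intro nn_integral_cmult_finite) auto
  finally show ?thesis .
qed

lemma modular_cong_AE: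
  fixes f g :: "'a \<Rightarrow> 'k::real_normed_vector"
  assumes "f \<in> borel_measurable M" "g \<in> borel_measurable M" and "AE x in M. f x = g x"
  shows "modular f = modular g"
  unfolding modular_def using rearrangement_cong_AE[OF assms]
  by (intro nn_integral_cong_AE) auto

lemma modular_indicator:
  assumes "A \<in> sets M"
  shows "modular (\<lambda>x. if x \<in> A then 1 else 0 :: 'k::real_normed_algebra_1) = weighted_measure N v (R A)"
  unfolding modular_def weighted_measure_def using AE_notin_R_empty
  by (intro nn_integral_cong_AE, eventually_elim)
     (use assms in \<open>auto simp: rearrangement_indicator sets.sets_into_space split: split_indicator\<close>)

lemma modular_zero: "modular (\<lambda>x. 0 :: 'k::real_normed_algebra_1) = 0"
proof -
  have "weighted_measure N v (R {}) = (\<integral>\<^sup>+y. 0 \<partial>N)"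
    unfolding weighted_measure_def using AE_notin_R_empty by (intro nn_integral_cong_AE) auto
  then show ?thesis using modular_indicator[of "{}", where 'k = 'k] by simp
qed

text \<open>
  Twice the rearrangement of the rounded function is almost everywhere a dyadic sum over a
  down-closed set of integers, so \<open>dyadic_sum_downset\<close> turns its \<open>p\<close>-th power into a sum of
  indicators, which is integrated against \<open>v\<close> term by term. Only countably many level sets
  occur, so the exceptional null sets on which they are not nested can be collected.
\<close>

lemma modular_dyadic_floor:
  assumes [measurable]: "f \<in> borel_measurable M"
  shows "ennreal (2 powr p) * modular (\<lambda>x. dyadic_floor (norm (f x))) = ennreal (2 powr p - 1) * dyadic_sum f"
proof -
  let ?L = "dyadic_level M f"
  have "AE y in N. \<forall>i j. i \<le> j \<longrightarrow> y \<in> R (?L j) \<longrightarrow> y \<in> R (?L i)"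
    unfolding AE_all_countable
    using dyadic_level_antimono[of _ _ M f] by (auto intro!: R_mono_AE)
  then have "AE y in N. ennreal (2 powr p) * ennreal_powr (rearrangement M R (\<lambda>x. dyadic_floor (norm (f x))) y) p =
     ennreal (2 powr p - 1) * (\<integral>\<^sup>+j. ennreal (2 powr (p * j)) * indicator (R (?L j)) y \<partial>count_space UNIV)"
  proof eventually_elim
    case (elim y)
    have "ennreal (2 powr p) * ennreal_powr (rearrangement M R (\<lambda>x. dyadic_floor (norm (f x))) y) p
        = ennreal_powr (2 * rearrangement M R (\<lambda>x. dyadic_floor (norm (f x))) y) p"
      using ennreal_powr_ennreal[of 2 p] by (simp add: ennreal_powr_mult)
    also have "2 * rearrangement M R (\<lambda>x. dyadic_floor (norm (f x))) y
        = (\<integral>\<^sup>+j. ennreal (2 powr (1 * real_of_int j)) * indicator {j. y \<in> R (?L j)} j \<partial>count_space UNIV)"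
      unfolding rearrangement_dyadic_floor
      unfolding nn_integral_cmult_finite[of 2, simplified, symmetric]
    proof (intro nn_integral_cong)
      fix j :: int
      have "2 * ennreal (2 powr (real_of_int j - 1)) = ennreal (2 powr (1 * real_of_int j))"
        using ennreal_mult[of 2 "2 powr (real_of_int j - 1)"] by (simp add: powr_diff)
      then show "2 * (ennreal (2 powr (real_of_int j - 1)) * indicator (R (?L j)) y)
          = ennreal (2 powr (1 * real_of_int j)) * indicator {j. y \<in> R (?L j)} j"
        by (simp only: mult.assoc[symmetric]) (simp split: split_indicator)
    qed
    also have "ennreal_powr \<dots> p = ennreal (2 powr p - 1) *
        (\<integral>\<^sup>+j. ennreal (2 powr (p * j)) * indicator {j. y \<in> R (?L j)} j \<partial>count_space UNIV)"
      using p elim by (intro dyadic_sum_downset) auto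
    also have "(\<integral>\<^sup>+j. ennreal (2 powr (p * j)) * indicator {j. y \<in> R (?L j)} j \<partial>count_space UNIV)
        = (\<integral>\<^sup>+j. ennreal (2 powr (p * j)) * indicator (R (?L j)) y \<partial>count_space UNIV)"
      by (intro nn_integral_cong) (simp split: split_indicator)
    finally show ?case .
  qed
  then have eq: "AE y in N. ennreal (2 powr p) * (ennreal_powr (rearrangement M R (\<lambda>x. dyadic_floor (norm (f x))) y) p * ennreal (v y)) =
     ennreal (2 powr p - 1) * (\<integral>\<^sup>+j. ennreal (2 powr (p * j)) * indicator (R (?L j)) y * ennreal (v y) \<partial>count_space UNIV)"
    by eventually_elim (simp add: mult.assoc[symmetric] nn_integral_multc)
  have "ennreal (2 powr p) * modular (\<lambda>x. dyadic_floor (norm (f x))) =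
      (\<integral>\<^sup>+y. ennreal (2 powr p) * (ennreal_powr (rearrangement M R (\<lambda>x. dyadic_floor (norm (f x))) y) p * ennreal (v y)) \<partial>N)"
    unfolding modular_def by (rule nn_integral_cmult_finite[symmetric]) simp
  also have "\<dots> = ennreal (2 powr p - 1) *
      (\<integral>\<^sup>+y. (\<integral>\<^sup>+j. ennreal (2 powr (p * j)) * indicator (R (?L j)) y * ennreal (v y) \<partial>count_space UNIV) \<partial>N)"
    unfolding nn_integral_cong_AE[OF eq] using p one_less_two_powr[OF p]
    by (intro nn_integral_cmult_finite) auto
  also have "(\<integral>\<^sup>+y. (\<integral>\<^sup>+j. ennreal (2 powr (p * j)) * indicator (R (?L j)) y * ennreal (v y) \<partial>count_space UNIV) \<partial>N)
      = (\<integral>\<^sup>+j. (\<integral>\<^sup>+y. ennreal (2 powr (p * j)) * indicator (R (?L j)) y * ennreal (v y) \<partial>N) \<partial>count_space UNIV)"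
    by (rule nn_integral_count_space_nn_integral) auto
  also have "\<dots> = dyadic_sum f"
    unfolding dyadic_sum_def weighted_measure_def
    by (intro nn_integral_cong, subst nn_integral_cmult[symmetric]) (auto simp: ac_simps)
  finally show ?thesis .
qed

lemma dyadic_sum_le_modular:
  assumes [measurable]: "f \<in> borel_measurable M"
  shows "ennreal (2 powr p - 1) * dyadic_sum f \<le> ennreal (2 powr p) * modular f"
  unfolding modular_dyadic_floor[OF assms, symmetric]
  using dyadic_floor_bounds(1)
  by (intro mult_left_mono modular_mono) (auto simp: dyadic_floor_nonneg)

lemma modular_le_dyadic_sum:
  assumes [measurable]: "f \<in> borel_measurable M"
  shows "modular f \<le> ennreal (2 powr p - 1) * dyadic_sum f"
proof -
  have "modular f \<le> modular (\<lambda>x. 2 * dyadic_floor (norm (f x)))"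
    using dyadic_floor_bounds(2) by (intro modular_mono) (auto simp: dyadic_floor_nonneg)
  also have "\<dots> = ennreal (2 powr p - 1) * dyadic_sum f"
    by (simp add: modular_scale modular_dyadic_floor)
  finally show ?thesis .
qed

text \<open>
  One factor \<open>2 powr p\<close> comes from the shift from level \<open>j\<close> to level \<open>j - 1\<close>, the other from passing
  from the functional to the dyadic sum and back.
\<close>

lemma modular_add_le:
  fixes f g :: "'a \<Rightarrow> 'k::{real_normed_vector, second_countable_topology}"
  assumes f [measurable]: "f \<in> borel_measurable M" and g [measurable]: "g \<in> borel_measurable M"
    and C: "\<And>A B. A \<in> sets M \<Longrightarrow> B \<in> sets M \<Longrightarrow>
        weighted_measure N v (R (A \<union> B)) \<le> ennreal C * (weighted_measure N v (R A) + weighted_measure N v (R B))"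
  shows "modular (\<lambda>x. f x + g x) \<le> ennreal C * ennreal (2 powr p) * ennreal (2 powr p) * (modular f + modular g)"
proof -
  let ?V = "\<lambda>f j. weighted_measure N v (R (dyadic_level M f j))"
  have shift: "(\<integral>\<^sup>+j. ennreal (2 powr (p * j)) * ?V h (j - 1) \<partial>count_space UNIV)
      = ennreal (2 powr p) * dyadic_sum h" for h :: "'a \<Rightarrow> 'k"
  proof -
    have "(\<integral>\<^sup>+j. ennreal (2 powr (p * j)) * ?V h (j - 1) \<partial>count_space UNIV)
        = (\<integral>\<^sup>+j. ennreal (2 powr (p * (j + 1))) * ?V h (j + 1 - 1) \<partial>count_space UNIV)"
      using nn_integral_bij_count_space[of "\<lambda>j::int. j + 1" UNIV UNIV
          "\<lambda>j. ennreal (2 powr (p * j)) * ?V h (j - 1)"] bij_betwI[of "\<lambda>j::int. j + 1" UNIV UNIV "\<lambda>j. j - 1"]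
      by auto
    also have "\<dots> = (\<integral>\<^sup>+j. ennreal (2 powr p) * (ennreal (2 powr (p * j)) * ?V h j) \<partial>count_space UNIV)"
      by (simp add: distrib_left powr_add ennreal_mult ac_simps)
    also have "\<dots> = ennreal (2 powr p) * dyadic_sum h"
      by (simp add: nn_integral_cmult dyadic_sum_def)
    finally show ?thesis .
  qed
  have V: "?V (\<lambda>x. f x + g x) j \<le> ennreal C * (?V f (j - 1) + ?V g (j - 1))" for j
  proof -
    have "?V (\<lambda>x. f x + g x) j \<le> weighted_measure N v (R (dyadic_level M f (j - 1) \<union> dyadic_level M g (j - 1)))"
      by (intro weighted_measure_R_mono dyadic_level_add) auto
    also have "\<dots> \<le> ennreal C * (?V f (j - 1) + ?V g (j - 1))"
      by (rule C) auto
    finally show ?thesis .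
  qed
  have "dyadic_sum (\<lambda>x. f x + g x) \<le> (\<integral>\<^sup>+j. ennreal C *
      (ennreal (2 powr (p * j)) * ?V f (j - 1) + ennreal (2 powr (p * j)) * ?V g (j - 1)) \<partial>count_space UNIV)"
    unfolding dyadic_sum_def
  proof (intro nn_integral_mono)
    fix j :: int
    show "ennreal (2 powr (p * j)) * ?V (\<lambda>x. f x + g x) j \<le> ennreal C *
      (ennreal (2 powr (p * j)) * ?V f (j - 1) + ennreal (2 powr (p * j)) * ?V g (j - 1))"
      using mult_left_mono[OF V[of j], of "ennreal (2 powr (p * j))"] by (simp add: distrib_left ac_simps)
  qed
  also have "\<dots> = ennreal C * (ennreal (2 powr p) * (dyadic_sum f + dyadic_sum g))"
    by (simp add: nn_integral_cmult nn_integral_add shift distrib_left)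
  finally have "modular (\<lambda>x. f x + g x) \<le>
      ennreal (2 powr p - 1) * (ennreal C * (ennreal (2 powr p) * (dyadic_sum f + dyadic_sum g)))"
    using modular_le_dyadic_sum[of "\<lambda>x. f x + g x"] by (auto intro: order_trans[OF _ mult_left_mono])
  also have "\<dots> = ennreal C * ennreal (2 powr p) *
      (ennreal (2 powr p - 1) * dyadic_sum f + ennreal (2 powr p - 1) * dyadic_sum g)"
    by (simp add: distrib_left ac_simps)
  also have "\<dots> \<le> ennreal C * ennreal (2 powr p) * (ennreal (2 powr p) * modular f + ennreal (2 powr p) * modular g)"
    by (intro mult_left_mono add_mono dyadic_sum_le_modular f g) auto
  finally show ?thesis by (simp add: distrib_left ac_simps)
qed

text \<open>
  If the functional vanishes then every dyadic level is mapped to a set of weight zero, hence is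
  null by positivity of the weight; the levels exhaust \<open>{f \<noteq> 0}\<close>.
\<close>

lemma modular_eq_0_iff:
  fixes f :: "'a \<Rightarrow> 'k::real_normed_algebra_1"
  assumes f [measurable]: "f \<in> borel_measurable M"
  shows "modular f = 0 \<longleftrightarrow> (AE x in M. f x = 0)"
proof
  assume "AE x in M. f x = 0"
  then show "modular f = 0"
    using modular_cong_AE[of f "\<lambda>x. 0"] modular_zero[where 'k = 'k] by simp
next
  assume "modular f = 0"
  then have "ennreal (2 powr p - 1) * dyadic_sum f = 0"
    using dyadic_sum_le_modular[OF f] by simp
  then have "dyadic_sum f = 0"
    using p one_less_two_powr[OF p] by (auto simp: ennreal_eq_0_iff)
  then have "\<forall>j. weighted_measure N v (R (dyadic_level M f j)) = 0"
    by (simp add: dyadic_sum_def nn_integral_0_iff_AE AE_count_space ennreal_eq_0_iff)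
  then have "\<forall>j. emeasure M (dyadic_level M f j) = 0"
    using weight sets_dyadic_level[OF f] unfolding weight_def by (metis less_irrefl not_gr_zero)
  then have "AE x in M. \<forall>j. x \<notin> dyadic_level M f j"
    unfolding AE_all_countable by (auto intro!: AE_not_in simp: null_sets_def)
  with AE_space show "AE x in M. f x = 0"
  proof eventually_elim
    case (elim x)
    show "f x = 0"
    proof (rule ccontr)
      \<comment> \<open>the power of two with exponent \<open>\<lfloor>log 2 (norm (f x))\<rfloor> - 1\<close> is strictly below the norm\<close>
      assume "f x \<noteq> 0"
      moreover have "norm (f x) \<le> 2 powr (\<lfloor>log 2 (norm (f x))\<rfloor> - 1)"
        using elim by (auto simp: dyadic_level_def not_less dest: spec[of _ "\<lfloor>log 2 (norm (f x))\<rfloor> - 1"])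
      ultimately have "log 2 (norm (f x)) \<le> \<lfloor>log 2 (norm (f x))\<rfloor> - 1"
        by (simp add: log_le_iff)
      then show False by linarith
    qed
  qed
qed

section \<open>The quasi-triangle inequality and subadditivity\<close>

lemma quasi_norm_if_subadditive:
  assumes C: "C > 0" "\<And>A B. A \<in> sets M \<Longrightarrow> B \<in> sets M \<Longrightarrow>
        weighted_measure N v (R (A \<union> B)) \<le> ennreal C * (weighted_measure N v (R A) + weighted_measure N v (R B))"
  shows "quasi_norm_mod_ae M
           (lorentz_space M N R v p :: ('a \<Rightarrow> 'k::{real_normed_field, second_countable_topology}) set)
           (lorentz_norm M N R v p)"
proof -
  let ?q = "lorentz_norm M N R v p :: ('a \<Rightarrow> 'k) \<Rightarrow> ennreal"
  define K where "K = (C * 2 powr p * 2 powr p) powr (1 / p) * 2 powr (1 / p)"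
  have K: "K > 0" using C by (simp add: K_def)
  have triangle: "?q (\<lambda>x. f x + g x) \<le> ennreal K * (?q f + ?q g)"
    if "f \<in> borel_measurable M" "g \<in> borel_measurable M" for f g
  proof -
    have "?q (\<lambda>x. f x + g x) \<le> ennreal_powr (ennreal (C * 2 powr p * 2 powr p) * (modular f + modular g)) (1 / p)"
      unfolding lorentz_norm_eq_modular
      using modular_add_le[OF that, of C] C p by (intro ennreal_powr_mono) (auto simp: ennreal_mult)
    also have "\<dots> \<le> ennreal ((C * 2 powr p * 2 powr p) powr (1 / p)) *
        (ennreal (2 powr (1 / p)) * (?q f + ?q g))"
      unfolding lorentz_norm_eq_modular ennreal_powr_mult
      using C p by (subst ennreal_powr_ennreal) (auto intro!: mult_left_mono ennreal_powr_add_le)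
    also have "\<dots> = ennreal K * (?q f + ?q g)"
      by (simp add: K_def ennreal_mult mult.assoc)
    finally show ?thesis .
  qed
  have scale: "?q (\<lambda>x. c * f x) = ennreal (norm c) * ?q f" if "f \<in> borel_measurable M" for c f
  proof (cases "c = 0")
    case True
    then show ?thesis by (simp add: lorentz_norm_eq_modular modular_zero)
  next
    case False
    then show ?thesis using p
      by (simp add: lorentz_norm_eq_modular modular_scale ennreal_powr_mult powr_powr)
  qed
  have cong: "?q f = ?q g"
    if "f \<in> borel_measurable M" "g \<in> borel_measurable M" "AE x in M. f x = g x" for f g
    using modular_cong_AE[OF that] by (simp add: lorentz_norm_eq_modular)
  have S: "f \<in> lorentz_space M N R v p \<longleftrightarrow> f \<in> borel_measurable M \<and> ?q f < \<infinity>" for f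
    by (simp add: lorentz_space_def)
  have zero: "?q (\<lambda>x. 0) = 0"
    by (simp add: lorentz_norm_eq_modular modular_zero)
  show ?thesis
    unfolding quasi_norm_mod_ae_def
  proof (intro conjI ballI allI impI)
    fix f g :: "'a \<Rightarrow> 'k"
    assume f: "f \<in> lorentz_space M N R v p" and g: "g \<in> lorentz_space M N R v p"
    have "ennreal K * (?q f + ?q g) < \<infinity>"
      using f g by (simp add: S ennreal_mult_less_top)
    then show "(\<lambda>x. f x + g x) \<in> lorentz_space M N R v p"
      using f g triangle[of f g] by (auto simp: S intro: le_less_trans)
  next
    fix f :: "'a \<Rightarrow> 'k" and c assume f: "f \<in> lorentz_space M N R v p"
    then have [measurable]: "f \<in> borel_measurable M" by (simp add: S)
    show "(\<lambda>x. c * f x) \<in> lorentz_space M N R v p"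
      using f by (simp add: S scale ennreal_mult_less_top)
    show "?q (\<lambda>x. c * f x) = ennreal (norm c) * ?q f"
      using f by (simp add: S scale)
  next
    fix f :: "'a \<Rightarrow> 'k" assume f: "f \<in> lorentz_space M N R v p"
    then show "?q f < \<infinity>" by (simp add: S)
    show "?q f = 0 \<longleftrightarrow> (AE x in M. f x = 0)"
      using f by (simp add: S modular_eq_0_iff lorentz_norm_eq_modular)
  next
    fix f g :: "'a \<Rightarrow> 'k"
    assume f: "f \<in> lorentz_space M N R v p" and g: "g \<in> borel_measurable M"
      and eq: "AE x in M. f x = g x"
    then have "?q f = ?q g" by (intro cong) (auto simp: S)
    with f g show "g \<in> lorentz_space M N R v p" "?q g = ?q f" by (auto simp: S)
  next
    show "(\<lambda>x. 0 :: 'k) \<in> lorentz_space M N R v p" by (simp add: S zero)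
  next
    show "\<exists>K>0. \<forall>f\<in>lorentz_space M N R v p. \<forall>g\<in>lorentz_space M N R v p.
        ?q (\<lambda>x. f x + g x) \<le> ennreal K * (?q f + ?q g)"
      using K triangle by (intro exI[of _ K]) (auto simp: S)
  qed
qed

text \<open>
  If \<open>V (R A)\<close> or \<open>V (R B)\<close> is infinite there is nothing to prove; otherwise both indicators lie in
  the space. Their sum is at least the indicator of the union, and the functional of an indicator
  is \<open>V (R A)\<close> to the power \<open>1 / p\<close>.
\<close>

lemma subadditive_if_quasi_norm:
  assumes "quasi_norm_mod_ae M
           (lorentz_space M N R v p :: ('a \<Rightarrow> 'k::{real_normed_field, second_countable_topology}) set)
           (lorentz_norm M N R v p)"
  obtains C where "C > 0" "\<And>A B. A \<in> sets M \<Longrightarrow> B \<in> sets M \<Longrightarrow>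
        weighted_measure N v (R (A \<union> B)) \<le> ennreal C * (weighted_measure N v (R A) + weighted_measure N v (R B))"
proof -
  let ?V = "\<lambda>A. weighted_measure N v (R A)"
  let ?\<chi> = "\<lambda>A x. if x \<in> A then 1 else 0 :: 'k"
  let ?q = "lorentz_norm M N R v p :: ('a \<Rightarrow> 'k) \<Rightarrow> ennreal"
  obtain K where K: "K > 0" "\<And>f g. f \<in> lorentz_space M N R v p \<Longrightarrow> g \<in> lorentz_space M N R v p \<Longrightarrow>
      ?q (\<lambda>x. f x + g x) \<le> ennreal K * (?q f + ?q g)"
    using assms unfolding quasi_norm_mod_ae_def by blast
  define C where "C = K powr p * 2 powr p"
  have "C > 0" using K by (simp add: C_def)
  moreover have "?V (A \<union> B) \<le> ennreal C * (?V A + ?V B)" if [measurable]: "A \<in> sets M" "B \<in> sets M" for A B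
  proof (cases "?V A < top \<and> ?V B < top")
    case True
    have q: "?q (?\<chi> D) = ennreal_powr (?V D) (1 / p)" if "D \<in> sets M" for D
      using that by (simp add: lorentz_norm_eq_modular modular_indicator)
    have "?q (?\<chi> (A \<union> B)) \<le> ?q (\<lambda>x. ?\<chi> A x + ?\<chi> B x)"
      unfolding lorentz_norm_eq_modular using p
      by (intro ennreal_powr_mono modular_mono) auto
    also have "\<dots> \<le> ennreal K * (?q (?\<chi> A) + ?q (?\<chi> B))"
      using True by (intro K) (auto simp: lorentz_space_def q)
    finally have "ennreal_powr (ennreal_powr (?V (A \<union> B)) (1 / p)) p
        \<le> ennreal_powr (ennreal K * (ennreal_powr (?V A) (1 / p) + ennreal_powr (?V B) (1 / p))) p"
      using p q[of A] q[of B] q[of "A \<union> B"] that by (intro ennreal_powr_mono) (simp_all only: sets.Un less_imp_le)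
    then have "?V (A \<union> B) \<le> ennreal (K powr p) * ennreal_powr (ennreal_powr (?V A) (1 / p) + ennreal_powr (?V B) (1 / p)) p"
      using p K(1) by (simp add: ennreal_powr_powr ennreal_powr_exponent_1 ennreal_powr_mult)
    also have "\<dots> \<le> ennreal (K powr p) * (ennreal (2 powr p) *
        (ennreal_powr (ennreal_powr (?V A) (1 / p)) p + ennreal_powr (ennreal_powr (?V B) (1 / p)) p))"
      using p by (intro mult_left_mono ennreal_powr_add_le) auto
    also have "\<dots> = ennreal C * (?V A + ?V B)"
      using p by (simp add: ennreal_powr_powr ennreal_powr_exponent_1 C_def ennreal_mult mult.assoc)
    finally show ?thesis .
  next
    case False
    then have "?V A + ?V B = top" by (auto simp flip: top.not_eq_extremum)
    then show ?thesis unfolding \<open>?V A + ?V B = top\<close>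
      using \<open>C > 0\<close> by (simp add: ennreal_mult_top ennreal_eq_0_iff)
  qed
  ultimately show thesis by (rule that)
qed

end

theorem theorem3p2:
  fixes M :: "'a measure" and N :: "'b measure" and R :: "'a set \<Rightarrow> 'b set"
    and v :: "'b \<Rightarrow> real" and p :: real
  assumes "sigma_finite_measure M" and "sigma_finite_measure N"
    and "set_transformation M N R"
    and "fatou_property M N R"
    and "weight M N R v"
    and "0 < p"
  shows "quasi_norm_mod_ae M
           (lorentz_space M N R v p ::
              ('a \<Rightarrow> 'k::{real_normed_field, second_countable_topology}) set)
           (lorentz_norm M N R v p) \<longleftrightarrow>
         (\<exists>C::real. C > 0 \<and>
            (\<forall>A\<in>sets M. \<forall>B\<in>sets M.
               weighted_measure N v (R (A \<union> B)) \<le>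
                 ennreal C * (weighted_measure N v (R A) + weighted_measure N v (R B))))"
    (is "?quasi_norm \<longleftrightarrow> ?subadditive")
proof -
  interpret weighted_transformation M N R v p
    using assms by unfold_locales
  show ?thesis
  proof
    assume ?quasi_norm
    then show ?subadditive by (rule subadditive_if_quasi_norm) blast
  next
    assume ?subadditive
    then show ?quasi_norm using quasi_norm_if_subadditive by blast
  qed
qed

end
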